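(* For an atomic Puiseux monoid $M$ the following conditions are equivalent. (1) $M$ is dense. (2) $0$ is a limit point of $M^\bullet$. (3) $0$ is a limit point of any generating set of $M$ (that is, $0$ is a limit point of every generating set of $M$). (4) $0$ is a limit point of $\mathcal{A}(M)$.
   Context: A Puiseux monoid is an additive submonoid of $(\mathbb{Q}_{\ge 0},+)$. For a Puiseux monoid $M$, $M^\bullet = M\setminus\{0\}$. An atom of $M$ is an element $a\in M^\bullet$ such that whenever $a=u+v$ with $u,v\in M$, either $u=0$ or $v=0$; $\mathcal{A}(M)$ denotes the set of atoms of $M$. A subset $S\subseteq M$ is a generating set of $M$ if no proper submonoid of $M$ contains $S$. $M$ is atomic if $\mathcal{A}(M)$ is a generating set of $M$. $M$ is dense if it is a dense subset of $\mathbb{R}_{\ge 0}$ with the Euclidean topology. Limit points are taken in $\mathbb{R}$ with the Euclidean topology: $p$ is a limit point of $S$ if every neighborhood of $p$ contains a point of $S\setminus\{p\}$. *)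

theory Defs
  imports "HOL-Analysis.Analysis"
begin

text \<open>
  Rational numbers are viewed inside \<^typ>\<open>real\<close>, since limit points and density
  are taken with respect to the real line.
\<close>

definition add_submonoid :: "'a::monoid_add set \<Rightarrow> bool" where
  "add_submonoid N \<longleftrightarrow> 0 \<in> N \<and> (\<forall>x\<in>N. \<forall>y\<in>N. x + y \<in> N)"

definition puiseux_monoid :: "real set \<Rightarrow> bool" where
  "puiseux_monoid M \<longleftrightarrow> add_submonoid M \<and> M \<subseteq> \<rat> \<inter> {0..}"

definition atoms_of :: "'a::monoid_add set \<Rightarrow> 'a set" where
  "atoms_of M = {a \<in> M - {0}. \<forall>u\<in>M. \<forall>v\<in>M. a = u + v \<longrightarrow> u = 0 \<or> v = 0}"

definition generating_set :: "'a::monoid_add set \<Rightarrow> 'a set \<Rightarrow> bool" where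
  "generating_set M S \<longleftrightarrow> S \<subseteq> M \<and> \<not> (\<exists>N. add_submonoid N \<and> N \<subset> M \<and> S \<subseteq> N)"

definition atomic :: "'a::monoid_add set \<Rightarrow> bool" where
  "atomic M \<longleftrightarrow> generating_set M (atoms_of M)"

text \<open>
  The closure is taken in the subspace of nonnegative reals; as closure_of ignores points
  outside the space, membership in that space is stated separately.
\<close>

definition dense_monoid :: "real set \<Rightarrow> bool" where
  "dense_monoid M \<longleftrightarrow> M \<subseteq> {0..} \<and> (top_of_set {0..}) closure_of M = {0..}"

end

theory Submission
  imports Defs
begin

text \<open>
  The nonzero elements of size at least \<open>e\<close>, together with \<open>0\<close>, form a submonoid; hence a
  generating set that avoids \<open>(0, e)\<close> forces the whole monoid to avoid it, and the infimum of
  the nonzero elements is already visible on every generating set. Conversely, the multiples of an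
  element \<open>m\<close> with \<open>0 < m < e\<close> approximate every nonnegative real up to \<open>e\<close>.
\<close>

lemma zero_islimpt_nonneg_iff:
  fixes S :: "real set"
  assumes "S \<subseteq> {0..}"
  shows "0 islimpt S \<longleftrightarrow> (\<forall>e>0. \<exists>x\<in>S. 0 < x \<and> x < e)"
  unfolding islimpt_approachable
proof (intro all_cong1 imp_cong refl bex_cong)
  fix e x :: real
  assume "x \<in> S"
  with assms have "0 \<le> x" by auto
  then show "x \<noteq> 0 \<and> dist x 0 < e \<longleftrightarrow> 0 < x \<and> x < e"
    by (auto simp: dist_real_def)
qed

text \<open>For a set inside the half-line, the closure in the subspace is the trace on
  \<open>{0..}\<close> of the closure in the real line.\<close>

lemma dense_monoid_iff: "dense_monoid M \<longleftrightarrow> M \<subseteq> {0..} \<and> {0..} \<subseteq> closure M"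
  by (auto simp: dense_monoid_def closure_of_subtopology Int_absorb1)

lemma add_submonoid_of_nat_mult:
  fixes M :: "'a::semiring_1 set"
  assumes "add_submonoid M" and "x \<in> M"
  shows "of_nat n * x \<in> M"
  using assms by (induction n) (auto simp: add_submonoid_def distrib_right)

text \<open>Adding a summand that is at least \<open>e \<ge> 0\<close> to another such summand
  cannot bring the sum below \<open>e\<close>.\<close>

lemma add_submonoid_truncate:
  fixes M :: "'a::ordered_ab_group_add set"
  assumes "add_submonoid M" and "0 \<le> e"
  shows "add_submonoid (insert 0 (M \<inter> {e..}))"
  using assms by (auto simp: add_submonoid_def intro: add_increasing)

lemma dense_monoid_iff_zero_islimpt:
  assumes "add_submonoid M" and nonneg: "M \<subseteq> {0..}"
  shows "dense_monoid M \<longleftrightarrow> 0 islimpt (M - {0})"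
proof
  assume "dense_monoid M"
  then have dense: "{0..} \<subseteq> closure M"
    by (simp add: dense_monoid_iff)
  have "\<exists>x\<in>M - {0}. 0 < x \<and> x < e" if "e > 0" for e
  proof -
    \<comment> \<open>The ball of radius \<open>e / 2\<close> around \<open>e / 2\<close> is exactly
      the interval from \<open>0\<close> to \<open>e\<close> without its endpoints, so the
      approximating element is automatically nonzero.\<close>
    have "e / 2 \<in> closure M"
      using dense that by auto
    then obtain x where "x \<in> M" "dist x (e / 2) < e / 2"
      using half_gt_zero[OF \<open>e > 0\<close>] unfolding closure_approachable by blast
    then have "0 < x" "x < e"
      unfolding dist_real_def by linarith+
    with \<open>x \<in> M\<close> show ?thesis by auto
  qed
  then show "0 islimpt (M - {0})"
    using nonneg by (subst zero_islimpt_nonneg_iff) auto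
next
  assume lim: "0 islimpt (M - {0})"
  have "x \<in> closure M" if "0 \<le> x" for x
    unfolding closure_approachable
  proof (intro allI impI)
    fix e :: real
    assume "0 < e"
    with lim nonneg obtain m where m: "m \<in> M" "0 < m" "m < e"
      by (subst (asm) zero_islimpt_nonneg_iff) auto
    \<comment> \<open>\<open>real n * m\<close> is the largest multiple of \<open>m\<close> not
      exceeding \<open>x\<close>, so it misses \<open>x\<close> by less than \<open>m\<close>, hence
      by less than \<open>e\<close>.\<close>
    define n where "n = nat \<lfloor>x / m\<rfloor>"
    have "real n \<le> x / m" "x / m < real n + 1"
      using that m by (auto simp: n_def)
    then have "real n * m \<le> x" "x < real n * m + m"
      using m by (auto simp: field_simps)
    then have "dist (real n * m) x < e"
      using m by (simp add: dist_real_def)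
    with m show "\<exists>y\<in>M. dist y x < e"
      using add_submonoid_of_nat_mult[OF assms(1)] by blast
  qed
  with nonneg show "dense_monoid M"
    by (auto simp: dense_monoid_iff)
qed

lemma generating_set_zero_islimpt:
  fixes M :: "real set"
  assumes "add_submonoid M" and nonneg: "M \<subseteq> {0..}"
    and lim: "0 islimpt (M - {0})" and gen: "generating_set M S"
  shows "0 islimpt S"
proof (rule ccontr)
  assume "\<not> 0 islimpt S"
  moreover have "S \<subseteq> M"
    using gen by (simp add: generating_set_def)
  ultimately obtain e where e: "0 < e" "\<And>x. x \<in> S \<Longrightarrow> 0 < x \<Longrightarrow> e \<le> x"
    using nonneg by (subst (asm) zero_islimpt_nonneg_iff) force+
  \<comment> \<open>This submonoid contains \<open>S\<close>: positive elements of \<open>S\<close>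
    are at least \<open>e\<close>, and \<open>0\<close> is inserted. Generation then forces
    \<open>N = M\<close>, yet \<open>M\<close> has elements strictly between \<open>0\<close> and
    \<open>e\<close>.\<close>
  define N where "N = insert 0 (M \<inter> {e..})"
  have "add_submonoid N"
    unfolding N_def using assms(1) e(1) by (intro add_submonoid_truncate) auto
  moreover have "N \<subseteq> M"
    using assms(1) by (auto simp: N_def add_submonoid_def)
  moreover have "S \<subseteq> N"
    using e(2) \<open>S \<subseteq> M\<close> nonneg by (force simp: N_def)
  ultimately have "N = M"
    using gen by (auto simp: generating_set_def)
  moreover obtain m where "m \<in> M" "0 < m" "m < e"
    using lim nonneg e(1) by (subst (asm) zero_islimpt_nonneg_iff) auto
  ultimately have "m \<in> N" "0 < m" "m < e"
    by simp_all
  then show False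
    by (simp add: N_def)
qed

theorem proposition3p2:
  fixes M :: "real set"
  assumes "puiseux_monoid M" and "atomic M"
  shows "(dense_monoid M \<longleftrightarrow> 0 islimpt (M - {0})) \<and>
         (0 islimpt (M - {0}) \<longleftrightarrow> (\<forall>S. generating_set M S \<longrightarrow> 0 islimpt S)) \<and>
         ((\<forall>S. generating_set M S \<longrightarrow> 0 islimpt S) \<longleftrightarrow> 0 islimpt atoms_of M)"
proof -
  have M: "add_submonoid M" "M \<subseteq> {0..}"
    using assms(1) by (auto simp: puiseux_monoid_def)
  have "generating_set M (atoms_of M)"
    using assms(2) by (simp add: atomic_def)
  \<comment> \<open>This closes the cycle: by atomicity the atoms are one of the generating sets,
    and atoms are nonzero elements of \<open>M\<close>.\<close>
  moreover have "0 islimpt (M - {0})" if "0 islimpt atoms_of M"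
    using that by (rule islimpt_subset) (auto simp: atoms_of_def)
  ultimately show ?thesis
    using dense_monoid_iff_zero_islimpt[OF M] generating_set_zero_islimpt[OF M] by blast
qed

end
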